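(* Assume the continuum hypothesis ($2^{\aleph_0}=\aleph_1$). Then there exists a regular Lindel\"of topological space $X$ which is not metrizable such that $X\times X$ is the union of two subspaces, each of which is metrizable.
   Context: $X\times X$ carries the product topology; subspaces carry the subspace topology. *)

theory Defs
  imports "HOL-Analysis.Analysis"
begin

unbundle cardinal_syntax

end

theory Submission
  imports Defs "HOL-Library.Nat_Bijection" "HOL-Library.Countable_Set_Type"
begin

text \<open>A subset \<open>C\<close> of a separable metric space \<open>Y\<close> is refined by isolating the points of
  \<open>D = Y - C\<close>. If every open set containing \<open>C\<close> misses only countably many points and \<open>D\<close> is
  uncountable, the result is Lindelof but not metrizable. In its square, \<open>C \<times> D \<union> D \<times> C \<union> \<Delta>\<^sub>D\<close> is a
  topological sum of metrizable pieces. The rest, \<open>C \<times> C \<union> (D \<times> D - \<Delta>\<^sub>D)\<close>, is metrizable as soon as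
  some \<open>G\<^sub>\<delta>\<close> relation on \<open>Y\<close> holds throughout \<open>C\<close> and fails between distinct points of \<open>D\<close>.

  Here \<open>Y\<close> consists of sequences of vertices of the Rado graph, and two sequences are related if they are
  adjacent at infinitely many places. Under CH the points are chosen by recursion of length \<open>\<omega>\<^sub>1\<close>,
  each one eventually adjacent to all earlier points of \<open>C\<close> and eventually nonadjacent to all earlier
  points of \<open>D\<close>. At stage \<open>a\<close> the new point is taken outside the open set \<open>W a\<close> and put into \<open>C\<close>
  if that is possible; otherwise it is put into \<open>D\<close>, and then all later points lie in \<open>W a\<close>.\<close>

section \<open>Metrizing subspaces\<close>

text \<open>Both topologies are compared point by point: \<open>ball\<close> makes metric balls
  neighbourhoods in the subspace, \<open>nbhd\<close> gives the converse. No explicit description of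
  the open sets of the subspace is required.\<close>

lemma metrizable_space_subtopologyI:
  assumes "Metric_space S \<rho>" and S: "S \<subseteq> topspace T"
    and ball: "\<And>p e. p \<in> S \<Longrightarrow> e > 0 \<Longrightarrow>
      \<exists>V. openin T V \<and> p \<in> V \<and> (\<forall>q\<in>V \<inter> S. \<rho> p q < e)"
    and nbhd: "\<And>p V. p \<in> S \<Longrightarrow> openin T V \<Longrightarrow> p \<in> V \<Longrightarrow>
      \<exists>e>0. \<forall>q\<in>S. \<rho> p q < e \<longrightarrow> q \<in> V"
  shows "metrizable_space (subtopology T S)"
proof -
  interpret Metric_space S \<rho> by fact
  have "openin (subtopology T S) U \<longleftrightarrow> openin mtopology U" for U
  proof
    assume "openin (subtopology T S) U"
    then obtain V where V: "openin T V" "U = V \<inter> S"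
      by (auto simp: openin_subtopology)
    show "openin mtopology U"
      unfolding openin_mtopology
    proof (intro conjI allI impI)
      fix p assume "p \<in> U"
      then obtain e where "e > 0" "\<forall>q\<in>S. \<rho> p q < e \<longrightarrow> q \<in> V"
        using nbhd V by blast
      then show "\<exists>r>0. mball p r \<subseteq> U"
        using V by (auto simp: subset_iff)
    qed (use V in auto)
  next
    assume U: "openin mtopology U"
    show "openin (subtopology T S) U"
    proof (subst openin_subopen, intro ballI)
      fix p assume p: "p \<in> U"
      then obtain r where r: "r > 0" "mball p r \<subseteq> U" and pS: "p \<in> S"
        using U unfolding openin_mtopology by blast
      then obtain V where V: "openin T V" "p \<in> V" "\<forall>q\<in>V \<inter> S. \<rho> p q < r"
        using ball by blast
      then have "V \<inter> S \<subseteq> U"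
        using r pS by (auto simp: subset_iff)
      then show "\<exists>W. openin (subtopology T S) W \<and> p \<in> W \<and> W \<subseteq> U"
        using V pS by (auto simp: openin_subtopology)
    qed
  qed
  then have "subtopology T S = mtopology"
    by (simp add: topology_eq)
  then show ?thesis
    using metrizable_space_mtopology by simp
qed

text \<open>In a Lindelof metric space a uniformly separated set is countable, and \<open>D\<close>
  would be a countable union of such sets \<open>E n\<close>, sorted by the radius of an isolating
  ball.\<close>

lemma uncountable_isolated_imp_not_metrizable:
  assumes "Lindelof_space X" and D: "uncountable D" "\<And>d. d \<in> D \<Longrightarrow> openin X {d}"
  shows "\<not> metrizable_space X"
proof
  assume "metrizable_space X"
  then obtain M m where "Metric_space M m" and X: "X = Metric_space.mtopology M m"
    by (auto simp: metrizable_space_def)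
  interpret Metric_space M m by fact
  define r where "r n = 1 / real (Suc n)" for n
  define E where "E n = {d \<in> D. mball d (r n) \<subseteq> {d}}" for n
  have rpos: "r n > 0" for n
    by (simp add: r_def)
  have DM: "d \<in> M" if "d \<in> D" for d
    using D(2)[OF that] X by (auto simp: openin_mtopology)
  have "D \<subseteq> (\<Union>n. E n)"
  proof
    fix d assume d: "d \<in> D"
    then obtain e where e: "e > 0" "mball d e \<subseteq> {d}"
      using D(2) X by (auto simp: openin_mtopology)
    then obtain n where "r n < e"
      unfolding r_def using nat_approx_posE by blast
    then have "mball d (r n) \<subseteq> {d}"
      using e mball_subset_concentric[of "r n" e d] by fastforce
    then show "d \<in> (\<Union>n. E n)"
      using d by (auto simp: E_def)
  qed
  moreover have "countable (E n)" for n
  proof -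
    \<comment> \<open>With half the radius, two points in one member of the cover are closer than
      \<open>r n\<close>, so a member contains at most one point of \<open>E n\<close>.\<close>
    define \<U> where "\<U> = (\<lambda>x. mball x (r n / 2)) ` M"
    have "\<exists>\<V>. countable \<V> \<and> \<V> \<subseteq> \<U> \<and> \<Union>\<V> = topspace X"
      using assms(1) rpos[of n]
      by (intro Lindelof_spaceD) (auto simp: \<U>_def X)
    then obtain \<V> where \<V>: "countable \<V>" "\<V> \<subseteq> \<U>" "\<Union>\<V> = M"
      using X by auto
    have one: "d = d'" if "V \<in> \<V>" "d \<in> V" "d' \<in> V" "d \<in> E n" for V d d'
    proof -
      obtain x where "V = mball x (r n / 2)"
        using \<open>V \<in> \<V>\<close> \<V>(2) unfolding \<U>_def by blast
      then have *: "x \<in> M" "d \<in> M" "d' \<in> M" "m x d < r n / 2" "m x d' < r n / 2"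
        using that by auto
      then have "m d d' < r n"
        using triangle[of d x d'] commute[of x d] by linarith
      then have "d' \<in> mball d (r n)"
        using * by simp
      then show ?thesis
        using that by (auto simp: E_def)
    qed
    have "countable (\<Union>V\<in>\<V>. V \<inter> E n)"
    proof (rule countable_UN[OF \<V>(1)])
      fix V assume "V \<in> \<V>"
      show "countable (V \<inter> E n)"
      proof (cases "V \<inter> E n = {}")
        case False
        then obtain d where "d \<in> V" "d \<in> E n"
          by blast
        then have "V \<inter> E n \<subseteq> {d}"
          using one[OF \<open>V \<in> \<V>\<close>] by blast
        then show ?thesis
          by (rule countable_subset) simp
      qed simp
    qed
    moreover have "E n \<subseteq> (\<Union>V\<in>\<V>. V \<inter> E n)"
      using \<V>(3) DM by (auto simp: E_def)
    ultimately show ?thesis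
      using countable_subset by blast
  qed
  ultimately show False
    using D(1) countable_subset[of D "\<Union>n. E n"] by simp
qed

section \<open>Refining a metric topology by isolating points\<close>

text \<open>For injective \<open>x\<close> this is the Michael line construction applied to the
  metric pulled back along \<open>x\<close>. It lives on the index type, so its carrier is
  \<open>UNIV\<close>, and points outside \<open>C\<close> impose no condition on
  \<open>U\<close>.\<close>

definition isol_topology :: "('a \<Rightarrow> 'b::metric_space) \<Rightarrow> 'a set \<Rightarrow> 'a topology"
  where "isol_topology x C =
    topology (\<lambda>U. \<forall>a\<in>U \<inter> C. \<exists>e>0. \<forall>b. dist (x a) (x b) < e \<longrightarrow> b \<in> U)"

lemma openin_isol_topology:
  "openin (isol_topology x C) U \<longleftrightarrow>
    (\<forall>a\<in>U \<inter> C. \<exists>e>0. \<forall>b. dist (x a) (x b) < e \<longrightarrow> b \<in> U)"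
proof -
  let ?O = "\<lambda>U. \<forall>a\<in>U \<inter> C. \<exists>e>0. \<forall>b. dist (x a) (x b) < e \<longrightarrow> b \<in> U"
  have "?O (S \<inter> T)" if S: "?O S" and T: "?O T" for S T
  proof
    fix a assume a: "a \<in> S \<inter> T \<inter> C"
    obtain e where "e > 0" "\<forall>b. dist (x a) (x b) < e \<longrightarrow> b \<in> S"
      using S a by blast
    moreover obtain e' where "e' > 0" "\<forall>b. dist (x a) (x b) < e' \<longrightarrow> b \<in> T"
      using T a by blast
    ultimately show "\<exists>e>0. \<forall>b. dist (x a) (x b) < e \<longrightarrow> b \<in> S \<inter> T"
      by (intro exI[of _ "min e e'"]) auto
  qed
  moreover have "?O (\<Union>K)" if K: "\<forall>S\<in>K. ?O S" for K
  proof
    fix a assume "a \<in> \<Union>K \<inter> C"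
    then obtain S where S: "S \<in> K" "a \<in> S \<inter> C"
      by blast
    then obtain e where "e > 0" "\<forall>b. dist (x a) (x b) < e \<longrightarrow> b \<in> S"
      using K by blast
    then show "\<exists>e>0. \<forall>b. dist (x a) (x b) < e \<longrightarrow> b \<in> \<Union>K"
      using S(1) by blast
  qed
  ultimately have "istopology ?O"
    unfolding istopology_def by blast
  then show ?thesis
    by (simp add: isol_topology_def)
qed

lemma topspace_isol_topology [simp]: "topspace (isol_topology x C) = UNIV"
proof -
  have "openin (isol_topology x C) UNIV"
    by (auto simp: openin_isol_topology intro: zero_less_one)
  then show ?thesis
    using openin_subset by blast
qed

lemma openin_isol_topology_singleton: "d \<notin> C \<Longrightarrow> openin (isol_topology x C) {d}"
  by (simp add: openin_isol_topology)

lemma openin_isol_topology_vimage: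
  assumes "open V"
  shows "openin (isol_topology x C) (x -` V)"
  unfolding openin_isol_topology
proof
  fix a assume "a \<in> x -` V \<inter> C"
  then obtain e where "e > 0" "ball (x a) e \<subseteq> V"
    using assms by (auto elim: openE)
  then show "\<exists>e>0. \<forall>b. dist (x a) (x b) < e \<longrightarrow> b \<in> x -` V"
    by (auto simp: subset_iff)
qed

lemma closedin_isol_topology_singleton:
  assumes "inj x"
  shows "closedin (isol_topology x C) {a}"
proof -
  have "UNIV - {a} = x -` (- {x a})"
    using assms by (auto dest: injD)
  moreover have "openin (isol_topology x C) (x -` (- {x a}))"
    by (intro openin_isol_topology_vimage open_Compl closed_singleton)
  ultimately show ?thesis
    by (simp add: closedin_def)
qed

lemma t1_space_isol_topology: "inj x \<Longrightarrow> t1_space (isol_topology x C)"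
  by (simp add: t1_space_closedin_singleton closedin_isol_topology_singleton)

text \<open>A point of \<open>C\<close> is separated from a closed set by a metric ball of half the
  available radius; any other point is clopen.\<close>

lemma regular_space_isol_topology:
  assumes "inj x"
  shows "regular_space (isol_topology x C)"
  unfolding regular_space_def
proof (intro allI impI, elim conjE)
  \<comment> \<open>Sequences are embedded into \<open>nat \<Rightarrow> real\<close> because \<open>nat\<close> is not an instance of \<open>metric_space\<close>.\<close>
  let ?X = "isol_topology x C"
  fix K a assume K: "closedin ?X K" and a: "a \<in> topspace ?X - K"
  show "\<exists>U V. openin ?X U \<and> openin ?X V \<and> a \<in> U \<and> K \<subseteq> V \<and> disjnt U V"
  proof (cases "a \<in> C")
    case True
    have "openin ?X (- K)"
      using K by (simp add: closedin_def Compl_eq_Diff_UNIV)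
    then obtain e where e: "e > 0" "\<forall>b. dist (x a) (x b) < e \<longrightarrow> b \<in> - K"
      using True a unfolding openin_isol_topology by blast
    show ?thesis
    proof (intro exI conjI)
      show "openin ?X (x -` ball (x a) (e/2))" "openin ?X (x -` (- cball (x a) (e/2)))"
        by (auto intro!: openin_isol_topology_vimage)
      show "K \<subseteq> x -` (- cball (x a) (e/2))"
      proof
        fix b assume "b \<in> K"
        then have "\<not> dist (x a) (x b) < e"
          using e by auto
        then show "b \<in> x -` (- cball (x a) (e/2))"
          using e by simp
      qed
    qed (use e in \<open>auto simp: disjnt_iff\<close>)
  next
    case False
    have "openin ?X (UNIV - {a})"
      using closedin_isol_topology_singleton[OF assms, of C a] by (simp add: closedin_def)
    then show ?thesis
      using False a openin_isol_topology_singleton[of a C x]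
      by (intro exI[of _ "{a}"] exI[of _ "UNIV - {a}"]) (auto simp: disjnt_iff)
  qed
qed

lemma Lindelof_space_isol_topology:
  fixes x :: "'a \<Rightarrow> 'b::{metric_space, second_countable_topology}"
  assumes conc: "\<And>V. open V \<Longrightarrow> x ` C \<subseteq> V \<Longrightarrow> countable (- (x -` V))"
  shows "Lindelof_space (isol_topology x C)"
  unfolding Lindelof_space_alt
proof (intro allI impI, elim conjE)
  fix \<U> assume op: "\<forall>U\<in>\<U>. openin (isol_topology x C) U"
    and cov: "topspace (isol_topology x C) \<subseteq> \<Union>\<U>"
  \<comment> \<open>Metric open sets whose preimage fits into one member of the cover. Second
    countability reduces them to a countable family with the same union.\<close>
  define \<O> where "\<O> = {V. open V \<and> (\<exists>U\<in>\<U>. x -` V \<subseteq> U)}"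
  obtain \<O>' where \<O>': "\<O>' \<subseteq> \<O>" "countable \<O>'" "\<Union>\<O>' = \<Union>\<O>"
    by (rule Lindelof[of \<O>]) (auto simp: \<O>_def)
  have "\<forall>V\<in>\<O>. \<exists>U. U \<in> \<U> \<and> x -` V \<subseteq> U"
    by (auto simp: \<O>_def)
  then obtain f where f: "\<And>V. V \<in> \<O> \<Longrightarrow> f V \<in> \<U> \<and> x -` V \<subseteq> f V"
    by (auto simp: bchoice_iff)
  have "\<forall>a. \<exists>U. U \<in> \<U> \<and> a \<in> U"
    using cov by auto
  then obtain g where g: "\<And>a. g a \<in> \<U> \<and> a \<in> g a"
    by (auto simp: choice_iff)
  have "x ` C \<subseteq> \<Union>\<O>"
  proof
    fix y assume "y \<in> x ` C"
    then obtain c where c: "c \<in> C" "y = x c"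
      by auto
    then have "\<exists>e>0. \<forall>b. dist (x c) (x b) < e \<longrightarrow> b \<in> g c"
      using g[of c] op unfolding openin_isol_topology by blast
    then obtain e where "e > 0" "\<forall>b. dist (x c) (x b) < e \<longrightarrow> b \<in> g c"
      by blast
    then have "x -` ball (x c) e \<subseteq> g c" "y \<in> ball (x c) e"
      using c by auto
    then have "ball (x c) e \<in> \<O>" "y \<in> ball (x c) e"
      using g[of c] by (auto simp: \<O>_def)
    then show "y \<in> \<Union>\<O>"
      by blast
  qed
  then have "countable (- (x -` \<Union>\<O>))"
    by (intro conc) (auto simp: \<O>_def)
  then have "countable (f ` \<O>' \<union> g ` (- (x -` \<Union>\<O>)))"
    using \<O>'(2) by simp
  moreover have "f ` \<O>' \<union> g ` (- (x -` \<Union>\<O>)) \<subseteq> \<U>"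
    using f g \<O>'(1) by auto
  moreover have "a \<in> \<Union>(f ` \<O>' \<union> g ` (- (x -` \<Union>\<O>)))" for a
  proof (cases "x a \<in> \<Union>\<O>")
    case True
    then obtain V where "V \<in> \<O>'" "x a \<in> V"
      using \<O>'(3) by blast
    then show ?thesis
      using f[of V] \<O>'(1) by blast
  next
    case False
    then show ?thesis
      using g[of a] by blast
  qed
  then have "topspace (isol_topology x C) \<subseteq> \<Union>(f ` \<O>' \<union> g ` (- (x -` \<Union>\<O>)))"
    by (intro subsetI)
  ultimately show "\<exists>\<V>. countable \<V> \<and> \<V> \<subseteq> \<U> \<and> topspace (isol_topology x C) \<subseteq> \<Union>\<V>"
    by (intro exI[of _ "f ` \<O>' \<union> g ` (- (x -` \<Union>\<O>))"] conjI)
qed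

section \<open>Metrizable pieces of the square\<close>

text \<open>A basic box around \<open>(a,b)\<close>: a coordinate in \<open>C\<close> may move by
  less than \<open>e\<close>, and the disjunctions allow an isolated coordinate only to stay
  fixed.\<close>

lemma openin_prod_isol_topologyD:
  assumes "openin (prod_topology (isol_topology x C) (isol_topology x C)) V" "(a,b) \<in> V"
  obtains e where "e > 0"
    "\<And>a' b'. a' = a \<or> a \<in> C \<and> dist (x a) (x a') < e \<Longrightarrow>
      b' = b \<or> b \<in> C \<and> dist (x b) (x b') < e \<Longrightarrow> (a',b') \<in> V"
proof -
  have one: "\<exists>e>0. \<forall>a'. a' = a \<or> a \<in> C \<and> dist (x a) (x a') < e \<longrightarrow> a' \<in> A"
    if "openin (isol_topology x C) A" "a \<in> A" for a A
  proof (cases "a \<in> C")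
    case True
    then have "\<exists>e>0. \<forall>a'. dist (x a) (x a') < e \<longrightarrow> a' \<in> A"
      using that by (simp add: openin_isol_topology)
    then show ?thesis
      using that(2) by blast
  qed (use that in \<open>auto intro: zero_less_one\<close>)
  obtain A B where AB: "openin (isol_topology x C) A" "openin (isol_topology x C) B"
    "a \<in> A" "b \<in> B" "A \<times> B \<subseteq> V"
    using assms(1)[unfolded openin_prod_topology_alt, rule_format, OF assms(2)] by blast
  obtain e1 where e1: "e1 > 0" "\<forall>a'. a' = a \<or> a \<in> C \<and> dist (x a) (x a') < e1 \<longrightarrow> a' \<in> A"
    using one[OF AB(1,3)] by blast
  obtain e2 where e2: "e2 > 0" "\<forall>b'. b' = b \<or> b \<in> C \<and> dist (x b) (x b') < e2 \<longrightarrow> b' \<in> B"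
    using one[OF AB(2,4)] by blast
  show thesis
    using e1 e2 AB by (intro that[of "min e1 e2"]) auto
qed

text \<open>The extra term \<open>k\<close> need not vanish on the diagonal, and its triangle
  inequality is only required for distinct points. This admits both \<open>w p + w q\<close> and a
  0-1 distance between labels.\<close>

lemma Metric_space_prod_pullback_add:
  fixes x :: "'a \<Rightarrow> 'b::metric_space"
  assumes "inj x"
    and k: "\<And>p q. p \<noteq> q \<Longrightarrow> k p q \<ge> 0" "\<And>p q. k p q = k q p"
      "\<And>p q r. \<lbrakk>p \<noteq> q; q \<noteq> r; p \<noteq> r\<rbrakk> \<Longrightarrow> k p r \<le> k p q + k q r"
  shows "Metric_space S (\<lambda>p q. if p = q then 0 else
    dist (x (fst p)) (x (fst q)) + dist (x (snd p)) (x (snd q)) + k p q)"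
    (is "Metric_space S ?r")
proof
  fix p q r :: "'a \<times> 'a"
  show "0 \<le> ?r p q"
    using k(1) by simp
  show "?r p q = ?r q p"
    using k(2) by (simp add: dist_commute)
  have "p = q" if "?r p q = 0"
  proof (rule ccontr)
    assume "p \<noteq> q"
    then have "dist (x (fst p)) (x (fst q)) + dist (x (snd p)) (x (snd q)) + k p q = 0" "k p q \<ge> 0"
      using that k(1) by simp_all
    then have "dist (x (fst p)) (x (fst q)) = 0" "dist (x (snd p)) (x (snd q)) = 0"
      using zero_le_dist[of "x (fst p)" "x (fst q)"] zero_le_dist[of "x (snd p)" "x (snd q)"]
      by linarith+
    then have "fst p = fst q" "snd p = snd q"
      using assms(1) by (simp_all add: inj_eq)
    then show False
      using \<open>p \<noteq> q\<close> by (simp add: prod_eq_iff)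
  qed
  then show "?r p q = 0 \<longleftrightarrow> p = q"
    by (intro iffI) simp_all
  show "?r p r \<le> ?r p q + ?r q r"
  proof (cases "p = q \<or> q = r \<or> p = r")
    case True
    then show ?thesis
      using k(1)[of p q] k(1)[of q r] by auto
  next
    case False
    then show ?thesis
      using k(3)[of p q r] dist_triangle[of "x (fst p)" "x (fst r)" "x (fst q)"]
        dist_triangle[of "x (snd p)" "x (snd r)" "x (snd q)"] by simp
  qed
qed

text \<open>Adding \<open>w p + w q\<close> to the distance isolates every point of positive weight,
  while \<open>usc\<close> keeps the weight small near the points of \<open>C \<times> C\<close>,
  where the topology is the metric one.\<close>

lemma metrizable_square_weighted:
  fixes x :: "'a \<Rightarrow> 'b::metric_space" and w :: "'a \<times> 'a \<Rightarrow> real"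
  assumes "inj x"
    and w: "\<And>p. w p \<ge> 0" "\<And>a b. \<lbrakk>(a,b) \<in> S; a \<notin> C\<rbrakk> \<Longrightarrow> w (a,b) > 0"
    and S: "\<And>a b. (a,b) \<in> S \<Longrightarrow> a \<in> C \<longleftrightarrow> b \<in> C"
    and w0: "\<And>a b. \<lbrakk>(a,b) \<in> S; a \<in> C\<rbrakk> \<Longrightarrow> w (a,b) = 0"
    and usc: "\<And>a b e. \<lbrakk>(a,b) \<in> S; a \<in> C; e > 0\<rbrakk> \<Longrightarrow> \<exists>r>0. \<forall>a' b'.
       dist (x a) (x a') < r \<longrightarrow> dist (x b) (x b') < r \<longrightarrow> (a',b') \<in> S \<longrightarrow> w (a',b') < e"
  shows "metrizable_space (subtopology (prod_topology (isol_topology x C) (isol_topology x C)) S)"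
proof (rule metrizable_space_subtopologyI)
  let ?T = "prod_topology (isol_topology x C) (isol_topology x C)"
  let ?r = "\<lambda>p q. if p = q then 0 else
    dist (x (fst p)) (x (fst q)) + dist (x (snd p)) (x (snd q)) + (w p + w q)"
  show "Metric_space S ?r"
    using w(1) by (intro Metric_space_prod_pullback_add assms(1)) (auto simp: algebra_simps)
  show "S \<subseteq> topspace ?T"
    by simp
  fix p assume p: "p \<in> S"
  obtain a b where ab: "p = (a,b)"
    by force
  show "\<exists>V. openin ?T V \<and> p \<in> V \<and> (\<forall>q\<in>V \<inter> S. ?r p q < e)" if e: "e > 0" for e
  proof (cases "a \<in> C")
    case True
    obtain r where r: "r > 0" "\<forall>a' b'. dist (x a) (x a') < r \<longrightarrow> dist (x b) (x b') < r \<longrightarrow>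
        (a',b') \<in> S \<longrightarrow> w (a',b') < e/3"
      using usc[of a b "e/3"] p ab True e by auto
    \<comment> \<open>Two distances and the weight of \<open>q\<close> contribute less than
      \<open>e/3\<close> each; the weight of \<open>p\<close> is 0.\<close>
    define s where "s = min r (e/3)"
    have s: "s > 0" "s \<le> r" "s \<le> e/3"
      using r e by (auto simp: s_def)
    show ?thesis
    proof (intro exI conjI ballI)
      show "openin ?T ((x -` ball (x a) s) \<times> (x -` ball (x b) s))"
        by (simp add: openin_prod_Times_iff openin_isol_topology_vimage)
      fix q assume "q \<in> (x -` ball (x a) s) \<times> (x -` ball (x b) s) \<inter> S"
      then obtain a' b' where q: "q = (a',b')" "dist (x a) (x a') < s" "dist (x b) (x b') < s"
        "(a',b') \<in> S"
        by auto
      moreover have "w (a',b') < e/3"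
        using q r s by auto
      moreover have "w (a,b) = 0"
        using w0 p ab True by blast
      ultimately show "?r p q < e"
        using s ab e by simp
    qed (use s ab in auto)
  next
    case False
    then have "b \<notin> C"
      using S p ab by blast
    then have "openin ?T ({a} \<times> {b})"
      using False unfolding openin_prod_Times_iff by (simp add: openin_isol_topology_singleton)
    then show ?thesis
      using ab e by (intro exI[of _ "{a} \<times> {b}"]) auto
  qed
  show "\<exists>e>0. \<forall>q\<in>S. ?r p q < e \<longrightarrow> q \<in> V" if V: "openin ?T V" "p \<in> V" for V
  proof (cases "a \<in> C")
    case True
    then have "b \<in> C"
      using S p ab by blast
    obtain e where e: "e > 0" "\<And>a' b'. a' = a \<or> a \<in> C \<and> dist (x a) (x a') < e \<Longrightarrow>
      b' = b \<or> b \<in> C \<and> dist (x b) (x b') < e \<Longrightarrow> (a',b') \<in> V"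
      using openin_prod_isol_topologyD[OF V[unfolded ab]] by blast
    have "q \<in> V" if "?r p q < e" for q
    proof (cases "q = p")
      case False
      obtain a' b' where q: "q = (a',b')"
        by force
      then have "dist (x a) (x a') + dist (x b) (x b') + (w p + w q) < e"
        using that False ab by auto
      then have "dist (x a) (x a') < e" "dist (x b) (x b') < e"
        using w(1)[of p] w(1)[of q] zero_le_dist[of "x a" "x a'"] zero_le_dist[of "x b" "x b'"]
        by linarith+
      then show ?thesis
        using e(2)[of a' b'] True \<open>b \<in> C\<close> q by simp
    qed (use V in simp)
    then show ?thesis
      using e(1) by blast
  next
    case False
    \<comment> \<open>Every other point is at distance at least \<open>w p\<close> from
      \<open>p\<close>, so this radius isolates \<open>p\<close>.\<close>
    have "q \<in> V" if "?r p q < w p" for q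
    proof (cases "q = p")
      case False
      then have "dist (x (fst p)) (x (fst q)) + dist (x (snd p)) (x (snd q)) + (w p + w q) < w p"
        using that by auto
      then show ?thesis
        using w(1)[of q] zero_le_dist[of "x (fst p)" "x (fst q)"]
          zero_le_dist[of "x (snd p)" "x (snd q)"] by linarith
    qed (use V in simp)
    then show ?thesis
      using w(2)[of a b] p ab False by blast
  qed
qed

text \<open>Within a piece at most one coordinate varies, and it varies in \<open>C\<close>, where
  the topology is the metric one. Distinct pieces are put at distance at least 1.\<close>

lemma metrizable_square_mixed:
  fixes x :: "'a \<Rightarrow> 'b::metric_space" and C :: "'a set"
  assumes "inj x"
  defines "S \<equiv> C \<times> (-C) \<union> (-C) \<times> C \<union> {(d,d) | d. d \<notin> C}"
  shows "metrizable_space (subtopology (prod_topology (isol_topology x C) (isol_topology x C)) S)"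
proof (rule metrizable_space_subtopologyI)
  let ?T = "prod_topology (isol_topology x C) (isol_topology x C)"
  \<comment> \<open>The sets on which \<open>label\<close> is constant are the pieces \<open>C \<times> {d}\<close>, \<open>{d} \<times> C\<close> and \<open>{(d,d)}\<close>; they are
    open in \<open>S\<close>.\<close>
  define label where
    "label p = (if fst p \<in> C then None else Some (fst p), if snd p \<in> C then None else Some (snd p))"
    for p :: "'a \<times> 'a"
  let ?r = "\<lambda>p q. if p = q then 0 else
    dist (x (fst p)) (x (fst q)) + dist (x (snd p)) (x (snd q)) + (if label p = label q then 0 else 1)"
  show "Metric_space S ?r"
    by (intro Metric_space_prod_pullback_add assms(1)) auto
  show "S \<subseteq> topspace ?T"
    by simp
  fix p assume p: "p \<in> S"
  obtain a b where ab: "p = (a,b)"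
    by force
  \<comment> \<open>Deleting the other coordinate \<open>b\<close> keeps the diagonal point
    \<open>(b,b)\<close> out of the neighbourhood of \<open>(a,b)\<close> when \<open>b\<close> is
    isolated.\<close>
  define N where "N a b e = (if a \<in> C then x -` ball (x a) e - {b} else {a})" for a b e
  have N: "openin (isol_topology x C) (N a b e)" for a b e
  proof -
    have "openin (isol_topology x C) (x -` ball (x a) e - {b})"
      by (intro openin_diff openin_isol_topology_vimage closedin_isol_topology_singleton assms(1)) simp
    then show ?thesis
      using openin_isol_topology_singleton[of a C x] by (auto simp: N_def)
  qed
  show "\<exists>V. openin ?T V \<and> p \<in> V \<and> (\<forall>q\<in>V \<inter> S. ?r p q < e)" if e: "e > 0" for e
  proof (intro exI conjI ballI)
    show "openin ?T (N a b e \<times> N b a e)"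
      by (simp add: openin_prod_Times_iff N)
    show "p \<in> N a b e \<times> N b a e"
      using p ab e by (auto simp: S_def N_def)
    fix q assume "q \<in> N a b e \<times> N b a e \<inter> S"
    then show "?r p q < e"
      using p ab e by (auto simp: S_def N_def label_def split: if_splits)
  qed
  show "\<exists>e>0. \<forall>q\<in>S. ?r p q < e \<longrightarrow> q \<in> V" if V: "openin ?T V" "p \<in> V" for V
  proof -
    obtain e where e: "e > 0" "\<And>a' b'. a' = a \<or> a \<in> C \<and> dist (x a) (x a') < e \<Longrightarrow>
      b' = b \<or> b \<in> C \<and> dist (x b) (x b') < e \<Longrightarrow> (a',b') \<in> V"
      using openin_prod_isol_topologyD[OF V[unfolded ab]] by blast
    \<comment> \<open>Distance below 1 forces equal labels, so isolated coordinates of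
      \<open>p\<close> and \<open>q\<close> agree.\<close>
    have "q \<in> V" if q: "?r p q < min e 1" for q
    proof (cases "q = p")
      case False
      obtain a' b' where ab': "q = (a',b')"
        by force
      have d: "dist (x a) (x a') + dist (x b) (x b') + (if label p = label q then 0 else 1) < min e 1"
        using q False ab ab' by auto
      then have "label p = label q"
        using zero_le_dist[of "x a" "x a'"] zero_le_dist[of "x b" "x b'"]
        by (cases "label p = label q") simp_all
      moreover from this have "dist (x a) (x a') < e" "dist (x b) (x b') < e"
        using d zero_le_dist[of "x a" "x a'"] zero_le_dist[of "x b" "x b'"]
        by (simp_all del: zero_le_dist)
      ultimately show ?thesis
        using e(2)[of a' b'] ab ab' by (auto simp: label_def split: if_splits)
    qed (use V in simp)
    then show ?thesis
      using e(1) by (intro exI[of _ "min e 1"]) auto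
  qed
qed

section \<open>Sequences of vertices of the Rado graph\<close>

text \<open>The Rado graph, with loops.\<close>
definition adj :: "nat \<Rightarrow> nat \<Rightarrow> bool"
  where "adj u v \<longleftrightarrow> u = v \<or> u \<in> set_decode v \<or> v \<in> set_decode u"

lemma adj_refl [simp]: "adj u u"
  by (simp add: adj_def)

lemma adj_sym: "adj u v \<longleftrightarrow> adj v u"
  by (auto simp: adj_def)

lemma in_set_decode_imp_less: "k \<in> set_decode n \<Longrightarrow> k < n"
proof -
  assume "k \<in> set_decode n"
  then have "set_encode {k} \<le> n"
    by (metis empty_subsetI finite.intros insert_subset set_encode_inverse subset_decode_imp_le)
  then show "k < n"
    using less_exp[of k] by (simp add: set_encode_def del: less_exp)
qed

text \<open>The extension property of the Rado graph: the new vertex is the code of the wanted set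
  of neighbours.\<close>

lemma adj_extension:
  assumes "finite Z"
  shows "\<exists>v. v \<notin> Z \<and> (\<forall>z\<in>Z. adj v z \<longleftrightarrow> Q z)"
proof -
  obtain M where M: "\<forall>z\<in>Z. z < M"
    using finite_nat_set_iff_bounded assms by blast
  \<comment> \<open>The additional element \<open>M\<close> pushes the code above all of
    \<open>Z\<close>. Hence the code is new and is no bit of an element of \<open>Z\<close>, and
    adjacency is decided by \<open>A\<close> alone.\<close>
  define A where "A = insert M {z \<in> Z. Q z}"
  have A: "set_decode (set_encode A) = A"
    using assms by (intro set_encode_inverse) (simp add: A_def)
  then have "M < set_encode A"
    by (intro in_set_decode_imp_less) (simp add: A_def)
  then have less: "z < set_encode A" if "z \<in> Z" for z
    using M that by force
  have "set_encode A \<notin> set_decode z" "set_encode A \<noteq> z" if "z \<in> Z" for z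
    using less[OF that] in_set_decode_imp_less[of "set_encode A" z] by auto
  moreover have "z \<in> A \<longleftrightarrow> Q z" if "z \<in> Z" for z
    using that M by (auto simp: A_def)
  ultimately show ?thesis
    using A less by (intro exI[of _ "set_encode A"]) (auto simp: adj_def)
qed

text \<open>The value \<open>v\<close> occurring among the first \<open>n\<close> sequences at place \<open>n\<close> gets the colour of the first
  sequence taking it; for each fixed sequence this is eventually its own colour.\<close>
lemma adj_sequence_extension:
  assumes "countable I"
    and ne: "\<And>i j. \<lbrakk>i \<in> I; j \<in> I; c i \<noteq> c j\<rbrakk> \<Longrightarrow> \<forall>\<^sub>F n in sequentially. y i n \<noteq> y j n"
  shows "\<exists>x. \<forall>i\<in>I. \<forall>\<^sub>F n in sequentially. x n \<noteq> y i n \<and> (adj (x n) (y i n) \<longleftrightarrow> c i)"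
proof (cases "I = {}")
  case False
  define e where "e = from_nat_into I"
  have e: "range e = I"
    using assms(1) False by (simp add: e_def range_from_nat_into)
  define first where "first n v = (LEAST k. y (e k) n = v)" for n v
  have "\<forall>n. \<exists>v. v \<notin> (\<lambda>k. y (e k) n) ` {..n} \<and>
      (\<forall>z\<in>(\<lambda>k. y (e k) n) ` {..n}. adj v z \<longleftrightarrow> c (e (first n z)))"
    by (intro allI adj_extension) simp
  then obtain x where x: "\<And>n k. k \<le> n \<Longrightarrow> x n \<noteq> y (e k) n \<and>
      (adj (x n) (y (e k) n) \<longleftrightarrow> c (e (first n (y (e k) n))))"
    unfolding choice_iff by (metis atMost_iff imageI)
  have "\<forall>\<^sub>F n in sequentially. x n \<noteq> y i n \<and> (adj (x n) (y i n) \<longleftrightarrow> c i)" if "i \<in> I" for i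
  proof -
    obtain k where k: "i = e k"
      using e \<open>i \<in> I\<close> by blast
    have "\<forall>\<^sub>F n in sequentially. \<forall>j\<in>{j. j < k \<and> c (e j) \<noteq> c (e k)}. y (e j) n \<noteq> y (e k) n"
      using ne e by (intro eventually_ball_finite) auto
    then show ?thesis
      using eventually_ge_at_top[of k]
    proof eventually_elim
      case (elim n)
      let ?f = "first n (y (e k) n)"
      have "y (e ?f) n = y (e k) n"
        unfolding first_def by (rule LeastI) simp
      moreover have "?f \<le> k"
        unfolding first_def by (rule Least_le) simp
      ultimately have "c (e ?f) = c (e k)"
        using elim(1)[rule_format, of ?f] by (cases "?f = k") auto
      then show ?case
        using x[OF elim(2)] k by simp
    qed
  qed
  then show ?thesis
    by blast
qed simp

text \<open>\<open>P x c a\<close> consists of the candidates for stage \<open>a\<close>, given the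
  earlier choices. Demanding eventual difference as well as the right adjacency keeps
  \<open>adj_sequence_extension\<close> applicable at later stages.\<close>

lemma adj_recursive_family:
  fixes W :: "'a \<Rightarrow> (nat \<Rightarrow> nat) set" and R :: "'a rel"
  defines "P \<equiv> \<lambda>x c a. {y. \<forall>b. (b,a) \<in> R \<longrightarrow>
    (\<forall>\<^sub>F n in sequentially. y n \<noteq> x b n \<and> (adj (y n) (x b n) \<longleftrightarrow> c b))}"
  assumes R: "wf R" "total R" and cnt: "\<And>a. countable {b. (b,a) \<in> R}"
  shows "\<exists>x c. \<forall>a. x a \<in> P x c a \<and> (if c a then x a \<notin> W a else P x c a \<subseteq> W a)"
proof -
  \<comment> \<open>Point and colour are paired, since the recursion chooses one value per
    stage.\<close>
  define \<Phi> where "\<Phi> f a r \<longleftrightarrow> fst r \<in> P (fst \<circ> f) (snd \<circ> f) a \<and>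
    (if snd r then fst r \<notin> W a else P (fst \<circ> f) (snd \<circ> f) a \<subseteq> W a)"
    for f :: "'a \<Rightarrow> (nat \<Rightarrow> nat) \<times> bool" and a r
  have "\<exists>f. \<forall>a. \<Phi> f a (f a)"
  proof (rule dependent_wf_choice[OF R(1)])
    fix f g :: "'a \<Rightarrow> (nat \<Rightarrow> nat) \<times> bool" and a r
    assume "\<And>z. (z,a) \<in> R \<Longrightarrow> f z = g z"
    then have "P (fst \<circ> f) (snd \<circ> f) a = P (fst \<circ> g) (snd \<circ> g) a"
      by (simp add: P_def)
    then show "\<Phi> f a r = \<Phi> g a r"
      by (simp add: \<Phi>_def)
  next
    fix a f assume IH: "\<And>b. (b,a) \<in> R \<Longrightarrow> \<Phi> f b (f b)"
    have step: "\<forall>\<^sub>F n in sequentially. fst (f i) n \<noteq> fst (f j) n" if "(i,a) \<in> R" "(j,i) \<in> R" for i j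
    proof -
      have "\<forall>\<^sub>F n in sequentially. fst (f i) n \<noteq> fst (f j) n \<and>
          (adj (fst (f i) n) (fst (f j) n) \<longleftrightarrow> snd (f j))"
        using IH[OF that(1)] that(2) by (simp add: \<Phi>_def P_def)
      then show ?thesis
        by (rule eventually_mono) simp
    qed
    have "\<forall>\<^sub>F n in sequentially. fst (f i) n \<noteq> fst (f j) n"
      if "(i,a) \<in> R" "(j,a) \<in> R" "snd (f i) \<noteq> snd (f j)" for i j
    proof -
      \<comment> \<open>Different colours mean different stages; the later one chose its sequence
        eventually different from the earlier one.\<close>
      have "(i,j) \<in> R \<or> (j,i) \<in> R"
        using R(2) that(3) unfolding total_on_def by (metis UNIV_I)
      then show ?thesis
      proof
        assume "(i,j) \<in> R"
        then show ?thesis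
          using step[OF that(2)] by (force elim: eventually_mono)
      qed (use step[OF that(1)] in blast)
    qed
    then have "\<exists>y. \<forall>i\<in>{b. (b,a) \<in> R}. \<forall>\<^sub>F n in sequentially.
        y n \<noteq> fst (f i) n \<and> (adj (y n) (fst (f i) n) \<longleftrightarrow> snd (f i))"
      by (intro adj_sequence_extension cnt) auto
    then obtain y where y: "y \<in> P (fst \<circ> f) (snd \<circ> f) a"
      by (auto simp: P_def)
    show "\<exists>r. \<Phi> f a r"
    proof (cases "P (fst \<circ> f) (snd \<circ> f) a \<subseteq> W a")
      case True
      then show ?thesis
        using y by (intro exI[of _ "(y, False)"]) (simp add: \<Phi>_def)
    next
      case False
      then obtain z where "z \<in> P (fst \<circ> f) (snd \<circ> f) a" "z \<notin> W a"
        by blast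
      then show ?thesis
        by (intro exI[of _ "(z, True)"]) (simp add: \<Phi>_def)
    qed
  qed
  then obtain f where "\<forall>a. \<Phi> f a (f a)"
    by blast
  then show ?thesis
    by (intro exI[of _ "fst \<circ> f"] exI[of _ "snd \<circ> f"]) (simp add: \<Phi>_def)
qed
section \<open>The space under CH\<close>

text \<open>Proper initial segments of the cardinal order on the reals have smaller cardinality than
  the reals, which under CH means countable. The strict part of that order is used.\<close>

lemma CH_real_well_order:
  assumes CH: "ctwo ^c natLeq =o cardSuc natLeq"
  shows "\<exists>R :: real rel. wf R \<and> total R \<and> trans R \<and> (\<forall>a. countable {b. (b,a) \<in> R})"
proof (intro exI conjI allI)
  let ?r = "|UNIV :: real set|"
  have r: "Well_order ?r" "Field ?r = UNIV"
    by (rule card_of_Well_order, rule Field_card_of)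
  then have lin: "Linear_order ?r" "wf (?r - Id)"
    by (auto simp: well_order_on_def)
  show "wf (?r - Id)"
    by (fact lin)
  show "total (?r - Id)"
    using lin(1) r(2) by (auto simp: order_on_defs total_on_def)
  show "trans (?r - Id)"
    using lin(1) by (intro trans_diff_Id) (auto simp: order_on_defs)
  obtain h :: "real \<Rightarrow> nat set" where "inj h"
    using nat_sets_eqpoll_reals unfolding eqpoll_def by (meson bij_betw_def bij_betw_the_inv_into)
  then have "inj (\<lambda>a n. n \<in> h a)"
    by (auto simp: inj_def set_eq_iff fun_eq_iff)
  then have "?r \<le>o ctwo ^c natLeq"
    unfolding cexp_def ctwo_def by (subst card_of_ordLeq[symmetric]) (auto simp: Func_def Field_natLeq Field_card_of)
  then have "?r \<le>o cardSuc natLeq"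
    using CH ordLeq_ordIso_trans by blast
  fix a :: real
  have "|underS ?r a| <o ?r"
    by (intro card_of_underS card_of_Card_order) (simp add: r(2))
  then have "|underS ?r a| <o cardSuc natLeq"
    using \<open>?r \<le>o cardSuc natLeq\<close> ordLess_ordLeq_trans by blast
  then have "|underS ?r a| \<le>o natLeq"
    using cardSuc_ordLeq_ordLess natLeq_Card_order card_of_Card_order by blast
  then have "countable (underS ?r a)"
    by (simp add: countable_card_le_natLeq)
  then show "countable {b. (b,a) \<in> ?r - Id}"
    by (rule countable_subset[rotated]) (auto simp: underS_def)
qed

section \<open>Open sets indexed by reals, and weights of pairs of sequences\<close>

text \<open>An open set is the union of a subfamily of a countable basis, hence coded by a set of
  naturals and so by a real. Thus the stages of the recursion can run through all open sets.\<close>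

lemma real_enumeration_open_sets:
  "\<exists>\<O> :: real \<Rightarrow> 'b::second_countable_topology set. \<forall>V. open V \<longrightarrow> V \<in> range \<O>"
proof -
  obtain B :: "'b set set" where B: "countable B" "topological_basis B"
    using ex_countable_basis by blast
  obtain h :: "real \<Rightarrow> nat set" where h: "bij h"
    using eqpoll_sym[OF nat_sets_eqpoll_reals] unfolding eqpoll_def by blast
  have "V \<in> range (\<lambda>r. \<Union>(from_nat_into B ` h r))" if "open V" for V
  proof -
    obtain B' where B': "B' \<subseteq> B" "\<Union>B' = V"
      using B(2) \<open>open V\<close> unfolding topological_basis_def by blast
    have "from_nat_into B ` {n. from_nat_into B n \<in> B'} = B'"
    proof (intro equalityI subsetI)
      fix U assume "U \<in> B'"
      then have "from_nat_into B (to_nat_on B U) = U"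
        using B(1) B'(1) by (auto intro: from_nat_into_to_nat_on)
      then show "U \<in> from_nat_into B ` {n. from_nat_into B n \<in> B'}"
        using \<open>U \<in> B'\<close> by (intro image_eqI[of _ _ "to_nat_on B U"]) auto
    qed auto
    then have "V = \<Union>(from_nat_into B ` h (inv h {n. from_nat_into B n \<in> B'}))"
      using B'(2) h by (simp add: surj_f_inv_f bij_is_surj)
    then show ?thesis
      by blast
  qed
  then show ?thesis
    by blast
qed

text \<open>Finitely many coordinates can be controlled in the product topology, and naturals at
  distance below 1 are equal.\<close>

lemma dist_real_fun_locally_constant:
  fixes y :: "'a::countable \<Rightarrow> nat"
  assumes "finite F"
  shows "\<exists>r>0. \<forall>z. dist (real \<circ> y) (real \<circ> z) < r \<longrightarrow> (\<forall>n\<in>F. z n = y n)"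
proof -
  let ?U = "\<Inter>n\<in>F. (\<lambda>z::'a \<Rightarrow> real. z n) -` ball (real (y n)) 1"
  have "open ?U"
    using assms by (intro open_INT ballI open_vimage open_ball continuous_on_product_coordinates)
  moreover have "real \<circ> y \<in> ?U"
    by simp
  ultimately obtain r where r: "r > 0" "ball (real \<circ> y) r \<subseteq> ?U"
    by (rule openE)
  have "z n = y n" if "dist (real \<circ> y) (real \<circ> z) < r" "n \<in> F" for z n
  proof -
    have "real \<circ> z \<in> ?U"
      using r(2) that(1) by (meson mem_ball subsetD)
    then have "dist (real (y n)) (real (z n)) < 1"
      using that(2) by simp
    then show ?thesis
      by (simp add: dist_real_def)
  qed
  then show ?thesis
    using r(1) by blast
qed

text \<open>Agreement on \<open>m\<close> chosen places of adjacency is an open condition, so nearby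
  pairs have at least \<open>m\<close> such places. This supplies \<open>usc\<close> in
  \<open>metrizable_square_weighted\<close>.\<close>

lemma adj_weight_small:
  fixes y z :: "nat \<Rightarrow> nat"
  defines "N \<equiv> \<lambda>y z. {n. adj (y n) (z n)}"
  assumes inf: "infinite (N y z)" and "e > 0"
  shows "\<exists>r>0. \<forall>y' z'. dist (real \<circ> y) (real \<circ> y') < r \<longrightarrow> dist (real \<circ> z) (real \<circ> z') < r \<longrightarrow>
    finite (N y' z') \<longrightarrow> 1 / real (Suc (card (N y' z'))) < e"
proof -
  obtain m where m: "1 / real (Suc m) < e"
    using \<open>e > 0\<close> nat_approx_posE by blast
  obtain F where F: "finite F" "card F = m" "F \<subseteq> N y z"
    using infinite_arbitrarily_large[OF inf] by blast
  obtain r1 where r1: "r1 > 0" "\<forall>y'. dist (real \<circ> y) (real \<circ> y') < r1 \<longrightarrow> (\<forall>n\<in>F. y' n = y n)"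
    using dist_real_fun_locally_constant F(1) by blast
  obtain r2 where r2: "r2 > 0" "\<forall>z'. dist (real \<circ> z) (real \<circ> z') < r2 \<longrightarrow> (\<forall>n\<in>F. z' n = z n)"
    using dist_real_fun_locally_constant F(1) by blast
  have "1 / real (Suc (card (N y' z'))) < e"
    if "dist (real \<circ> y) (real \<circ> y') < min r1 r2" "dist (real \<circ> z) (real \<circ> z') < min r1 r2" "finite (N y' z')" for y' z'
  proof -
    have "F \<subseteq> N y' z'"
      using F(3) r1(2) r2(2) that by (auto simp: N_def)
    then have "m \<le> card (N y' z')"
      using F(2) card_mono that(3) by blast
    then have "1 / real (Suc (card (N y' z'))) \<le> 1 / real (Suc m)"
      by (intro divide_left_mono) auto
    then show ?thesis
      using m by simp
  qed
  then show ?thesis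
    using r1(1) r2(1) by (intro exI[of _ "min r1 r2"]) auto
qed

theorem theorem1:
  assumes CH: "ctwo ^c natLeq =o cardSuc natLeq"
  shows "\<exists>X :: real topology.
           regular_space X \<and> t1_space X \<and> Lindelof_space X \<and> \<not> metrizable_space X \<and>
           (\<exists>A B. A \<union> B = topspace (prod_topology X X) \<and>
                  metrizable_space (subtopology (prod_topology X X) A) \<and>
                  metrizable_space (subtopology (prod_topology X X) B))"
proof -
  obtain R :: "real rel" where R: "wf R" "total R" "trans R" "\<And>a. countable {b. (b,a) \<in> R}"
    using CH_real_well_order[OF CH] by blast
  obtain \<O> :: "real \<Rightarrow> (nat \<Rightarrow> real) set" where \<O>: "\<And>V. open V \<Longrightarrow> V \<in> range \<O>"
    using real_enumeration_open_sets by blast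
  \<comment> \<open>The stages \<open>a \<le> 0\<close> serve to make the set of isolated points uncountable.\<close>
  define W where "W a = (if a \<le> 0 then UNIV else {y. real \<circ> y \<in> \<O> (ln a)})" for a
  define P where "P x c a = {y. \<forall>b. (b,a) \<in> R \<longrightarrow>
    (\<forall>\<^sub>F n in sequentially. y n \<noteq> x b n \<and> (adj (y n) (x b n) \<longleftrightarrow> c b))}"
    for x :: "real \<Rightarrow> nat \<Rightarrow> nat" and c a
  obtain x c where xP: "\<And>a. x a \<in> P x c a"
    and xW: "\<And>a. if c a then x a \<notin> W a else P x c a \<subseteq> W a"
    using adj_recursive_family[OF R(1,2,4), of W] unfolding P_def by blast
  define C where "C = Collect c"
  \<comment> \<open>Sequences are embedded into \<open>nat \<Rightarrow> real\<close> because \<open>nat\<close> is not an instance of \<open>metric_space\<close>.\<close>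
  let ?X = "isol_topology (\<lambda>a. real \<circ> x a) C"
  let ?T = "prod_topology ?X ?X"
  have ev: "\<forall>\<^sub>F n in sequentially. x a n \<noteq> x b n \<and> (adj (x a n) (x b n) \<longleftrightarrow> b \<in> C)"
    if "(b,a) \<in> R" for a b
    using xP[of a] that by (simp add: P_def C_def)
  have R_cases: "(a,b) \<in> R \<or> (b,a) \<in> R" if "a \<noteq> b" for a b
    using R(2) that by (simp add: total_on_def)
  have "x a \<noteq> x b" if "(b,a) \<in> R" for a b
    using eventually_happens[OF ev[OF that]] by auto
  then have "x a \<noteq> x b" if "a \<noteq> b" for a b
    using R_cases[OF that] by metis
  then have inj: "inj (\<lambda>a. real \<circ> x a)"
    by (auto simp: inj_def fun_eq_iff)
  \<comment> \<open>The later of two distinct points is eventually adjacent to the earlier; on the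
    diagonal the loops of the graph make every place count.\<close>
  have adjC: "infinite {n. adj (x a n) (x b n)}" if "a \<in> C" "b \<in> C" for a b
  proof (cases "a = b")
    case False
    then have "\<forall>\<^sub>F n in sequentially. adj (x a n) (x b n)"
      using R_cases[of a b] ev[of a b] ev[of b a] that by (auto elim: eventually_mono simp: adj_sym)
    then have "\<exists>\<^sub>F n in sequentially. adj (x a n) (x b n)"
      by (intro eventually_frequently) simp
    then show ?thesis
      by (simp add: cofinite_eq_sequentially[symmetric] frequently_cofinite)
  qed simp
  have adjD: "finite {n. adj (x a n) (x b n)}" if "a \<notin> C" "b \<notin> C" "a \<noteq> b" for a b
  proof -
    have "\<forall>\<^sub>F n in sequentially. \<not> adj (x a n) (x b n)"
      using R_cases[of a b] ev[of a b] ev[of b a] that by (auto elim: eventually_mono simp: adj_sym)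
    then show ?thesis
      by (simp add: cofinite_eq_sequentially[symmetric] eventually_cofinite)
  qed
  have "Lindelof_space ?X"
  proof (rule Lindelof_space_isol_topology)
    fix V assume V: "open V" "(\<lambda>a. real \<circ> x a) ` C \<subseteq> V"
    then obtain r where "V = \<O> r"
      using \<O> by blast
    \<comment> \<open>\<open>exp r\<close> is positive and \<open>ln\<close> undoes
      \<open>exp\<close>, so \<open>V\<close> is the set treated at stage
      \<open>exp r\<close>.\<close>
    then have W: "W (exp r) = {y. real \<circ> y \<in> V}"
      by (simp add: W_def)
    \<comment> \<open>Otherwise the point chosen there would belong to \<open>C\<close> and lie
      outside \<open>V\<close>.\<close>
    have "\<not> c (exp r)"
      using V(2) xW[of "exp r"] W by (auto simp: C_def)
    then have "real \<circ> y \<in> V" if "y \<in> P x c (exp r)" for y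
      using xW[of "exp r"] W that by auto
    \<comment> \<open>By transitivity a later point meets all requirements of stage
      \<open>exp r\<close>, so it was a candidate there and lies in \<open>V\<close>.\<close>
    moreover have "x b \<in> P x c (exp r)" if "(exp r, b) \<in> R" for b
      using xP[of b] R(3) that unfolding P_def trans_def by blast
    ultimately have later: "(exp r, b) \<notin> R" if "real \<circ> x b \<notin> V" for b
      using that by blast
    have "- ((\<lambda>a. real \<circ> x a) -` V) \<subseteq> insert (exp r) {b. (b, exp r) \<in> R}"
    proof
      fix b assume "b \<in> - ((\<lambda>a. real \<circ> x a) -` V)"
      then show "b \<in> insert (exp r) {b. (b, exp r) \<in> R}"
        using later[of b] R_cases[of "exp r" b] by auto
    qed
    then show "countable (- ((\<lambda>a. real \<circ> x a) -` V))"
      by (rule countable_subset) (simp add: R(4))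
  qed
  moreover have "\<not> metrizable_space ?X"
  proof (rule uncountable_isolated_imp_not_metrizable[of _ "- C"])
    have "a \<notin> C" if "a \<le> 0" for a
      using xW[of a] that by (auto simp: C_def W_def)
    then have "{-1<..<0} \<subseteq> - C"
      by auto
    then show "uncountable (- C)"
      using uncountable_open_interval[of "-1" "0::real"] countable_subset by auto
  qed (use calculation openin_isol_topology_singleton in auto)
  \<comment> \<open>The weight is the reciprocal of one plus the number of places of adjacency. The
    infinite case is set to 0 separately because \<open>card\<close> is 0 there and would give
    weight 1.\<close>
  moreover have "metrizable_space (subtopology ?T (C \<times> C \<union> {(a,b). a \<notin> C \<and> b \<notin> C \<and> a \<noteq> b}))"
  proof (rule metrizable_square_weighted[OF inj, where w =
        "\<lambda>(a,b). if infinite {n. adj (x a n) (x b n)} then 0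
          else 1 / real (Suc (card {n. adj (x a n) (x b n)}))"])
    fix a b :: real and e :: real
    assume "(a,b) \<in> C \<times> C \<union> {(a,b). a \<notin> C \<and> b \<notin> C \<and> a \<noteq> b}" "a \<in> C" "e > 0"
    then obtain r where "r > 0" "\<forall>y' z'. dist (real \<circ> x a) (real \<circ> y') < r \<longrightarrow> dist (real \<circ> x b) (real \<circ> z') < r \<longrightarrow>
        finite {n. adj (y' n) (z' n)} \<longrightarrow> 1 / real (Suc (card {n. adj (y' n) (z' n)})) < e"
      using adj_weight_small[OF adjC[of a b]] by blast
    then show "\<exists>r>0. \<forall>a' b'. dist (real \<circ> x a) (real \<circ> x a') < r \<longrightarrow> dist (real \<circ> x b) (real \<circ> x b') < r \<longrightarrow>
        (a',b') \<in> C \<times> C \<union> {(a,b). a \<notin> C \<and> b \<notin> C \<and> a \<noteq> b} \<longrightarrow>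
        (case (a',b') of (a,b) \<Rightarrow> if infinite {n. adj (x a n) (x b n)} then 0
          else 1 / real (Suc (card {n. adj (x a n) (x b n)}))) < e"
      using \<open>e > 0\<close> by (intro exI[of _ r]) auto
  qed (use adjC adjD in auto)
  moreover have "metrizable_space (subtopology ?T (C \<times> (-C) \<union> (-C) \<times> C \<union> {(d,d) | d. d \<notin> C}))"
    by (rule metrizable_square_mixed[OF inj])
  moreover have "(C \<times> C \<union> {(a,b). a \<notin> C \<and> b \<notin> C \<and> a \<noteq> b}) \<union>
      (C \<times> (-C) \<union> (-C) \<times> C \<union> {(d,d) | d. d \<notin> C}) = topspace ?T"
    by auto
  ultimately show ?thesis
    using regular_space_isol_topology[OF inj] t1_space_isol_topology[OF inj] by blast
qed
end
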